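(* Assume there are sequences $\{\delta_n\in(0,1)\}$ and $\{p_n\in(0,1)\}$ such that for every sufficiently large $n$ and each $i\in[n]$ one of the following holds: (i) $P\{P(X_j>X_i\mid X_i)-P(X_j>X_i)\in[\delta_n,1],\ \forall j\in[n]\setminus\{i\}\}\ge p_n$; (ii) $P\{P(X_j>X_i\mid X_i)-P(X_j>X_i)\in[-1,-\delta_n],\ \forall j\in[n]\setminus\{i\}\}\ge p_n$; and assume $\delta_n^3p_n\gnsim n^{-1/3}$. Assume there exist $\theta>0$ and an absolute constant $C>0$ such that for all distinct $i,j\in[n]$, $$|P(X_i>X_j)-\theta|\le Cn^{-1/6}.$$ In addition, assume there exist $\eta^2>0$ and an absolute constant $C>0$ such that for all $i\in[n]$ and all $1\le j,k\le n$ with $j\ne i$ and $k\ne i$, $$|E\{P(X_j>X_i\mid X_i)P(X_k>X_i\mid X_i)\}-\eta^2|\le Cn^{-1/3}.$$ Assume $\eta^2\ne\theta^2$. Then, with $\sigma_n^2=\mathrm{Var}(U_n^{\rm Ken})$, $$|\mathrm{Var}^*(\sigma_n^{-1}U_n^{\rm Ken*})-\mathrm{Var}(\sigma_n^{-1}U_n^{\rm Ken})|\stackrel{P}{\to}0 .$$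
   Context: For each $n$, $X_1,\dots,X_n$ (a triangular array $X_{n,1},\dots,X_{n,n}$) are independent real random variables, not necessarily identically distributed, with distributions absolutely continuous with respect to Lebesgue measure (and possibly changing with $n$). $[n]=\{1,\dots,n\}$, $\mathbf 1(\cdot)$ is the indicator function, and $$U_n^{\rm Ken}=\frac{1}{n(n-1)}\sum_{i\ne j}\mathbf 1(j<i)\mathbf 1(X_j>X_i).$$ Given $X_1,\dots,X_n$, let $X_1^*,\dots,X_n^*$ be i.i.d. draws from the empirical distribution of $X_1,\dots,X_n$, and $U_n^{\rm Ken*}=\frac{1}{n(n-1)}\sum_{i\ne j}\mathbf 1(j<i)\mathbf 1(X_j^*>X_i^* )$; $\mathrm{Var}^*$ is the conditional variance given $X_1,\dots,X_n$. The constants $\theta,\eta^2,C$ do not depend on $n$. Order notation: $a_n\lesssim b_n$ (equivalently $b_n\gtrsim a_n$) means there is an absolute constant $C$ with $|a_n|\le C|b_n|$ for all sufficiently large $n$; $a_n\gnsim b_n$ means $a_n\gtrsim b_n$ holds but $a_n\lesssim b_n$ does not. *)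

theory Defs
  imports "HOL-Probability.Probability" "HOL-Library.Landau_Symbols"
begin

text \<open>Samples \<open>x\<^sub>1, \<dots>, x\<^sub>n\<close> are functions on \<open>nat\<close>, only the values at \<open>{1..n}\<close> being relevant.\<close>

definition U_Ken :: "nat \<Rightarrow> (nat \<Rightarrow> real) \<Rightarrow> real" where
  "U_Ken n x = 1 / (real n * (real n - 1)) *
     (\<Sum>i\<in>{1..n}. \<Sum>j\<in>{1..n} - {i}. of_bool (j < i) * of_bool (x j > x i))"

text \<open>The conditional probability of the event \<open>P\<close> given the sigma-algebra generated by
  the random variable \<open>Y\<close>, as a random variable (determined up to null sets).\<close>

definition cond_prob_given :: "'a measure \<Rightarrow> ('a \<Rightarrow> bool) \<Rightarrow> ('a \<Rightarrow> real) \<Rightarrow> 'a \<Rightarrow> real" where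
  "cond_prob_given M P Y =
     real_cond_exp M (vimage_algebra (space M) Y borel) (\<lambda>\<omega>. of_bool (P \<omega>))"

text \<open>Every observation index has mass \<open>1/n\<close>, so tied observations add up.\<close>

definition empirical_pmf :: "nat \<Rightarrow> (nat \<Rightarrow> real) \<Rightarrow> real pmf" where
  "empirical_pmf n x = map_pmf x (pmf_of_set {1..n})"

text \<open>The conditional joint law of the bootstrap sample, given that the observed sample is \<open>x\<close>:
  \<open>n\<close> independent draws from the empirical distribution of \<open>x\<close>. The value 0 is only the
  default taken outside the index set \<open>{1..n}\<close>.\<close>

definition bootstrap_pmf :: "nat \<Rightarrow> (nat \<Rightarrow> real) \<Rightarrow> (nat \<Rightarrow> real) pmf" where
  "bootstrap_pmf n x = Pi_pmf {1..n} 0 (\<lambda>_. empirical_pmf n x)"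

text \<open>Conditional variance of a statistic \<open>T\<close> of the bootstrap sample, given the observed
  sample \<open>x\<close>; substituting the random sample for \<open>x\<close> makes it a random variable.\<close>

definition bootstrap_var :: "nat \<Rightarrow> (nat \<Rightarrow> real) \<Rightarrow> ((nat \<Rightarrow> real) \<Rightarrow> real) \<Rightarrow> real" where
  "bootstrap_var n x T = measure_pmf.variance (bootstrap_pmf n x) T"

text \<open>The order relation ``\<open>a \<greatersim> b\<close> but not \<open>a \<lesssim> b\<close>''; note that
  this does not say that \<open>b\<close> is little-o of \<open>a\<close>.\<close>

definition gnsim :: "(nat \<Rightarrow> real) \<Rightarrow> (nat \<Rightarrow> real) \<Rightarrow> bool" where
  "gnsim a b \<longleftrightarrow> b \<in> O(a) \<and> a \<notin> O(b)"

text \<open>Convergence to 0 in probability, where the probability space may vary with \<open>n\<close>.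
  Measurability is required because \<open>measure\<close> is 0 on non-measurable sets.\<close>

definition tendsto_zero_in_prob :: "(nat \<Rightarrow> 'a measure) \<Rightarrow> (nat \<Rightarrow> 'a \<Rightarrow> real) \<Rightarrow> bool" where
  "tendsto_zero_in_prob M Y \<longleftrightarrow>
     (\<forall>n. Y n \<in> borel_measurable (M n)) \<and>
     (\<forall>\<epsilon>>0. (\<lambda>n. \<P>(\<omega> in M n. \<bar>Y n \<omega>\<bar> > \<epsilon>)) \<longlonglongrightarrow> 0)"

end

theory Submission
  imports Defs
begin

text \<open>
  Up to the factor \<open>1 / (n (n - 1))\<close>, the statistic counts inversions of the sample, so its
  variance is a sum of covariances of pairs of order events \<open>X\<^sub>i < X\<^sub>j\<close> and \<open>X\<^sub>k < X\<^sub>l\<close>. Under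
  independence a pair contributes only if the two events share an index, and then its covariance is
  determined by the probabilities of the orders of two or three observations.

  These probabilities are nearly those of an i.i.d. continuous sample. The events \<open>X\<^sub>i < X\<^sub>j\<close> and
  \<open>X\<^sub>j < X\<^sub>i\<close> both have probability close to \<open>\<theta>\<close>, and since ties are null events the two
  probabilities add up to 1: both are close to \<open>1/2\<close>. In the same way, each of three observations is
  the smallest with probability close to \<open>\<eta>\<^sup>2\<close>, hence close to \<open>1/3\<close>, because by Fubini
  \<open>P(X\<^sub>j > X\<^sub>i | X\<^sub>i)\<close> is the survival function of \<open>X\<^sub>j\<close> at \<open>X\<^sub>i\<close> and the expectation
  of a product of two of them is \<open>P(X\<^sub>i < X\<^sub>j, X\<^sub>i < X\<^sub>k)\<close> (\<open>expectation_cond_prob_product\<close>). The number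
  of inversions therefore has variance \<open>n\<^sup>3/36 + O(e n\<^sup>3 + n\<^sup>2)\<close>, where \<open>e\<close> measures how far the
  order probabilities are from being symmetric under a swap of two observations and bounds the
  probability of ties (\<open>variance_inversions_approx\<close>). Here \<open>e = O(n powr (-1/6))\<close>.

  The same estimate covers the bootstrap. Almost surely the observations are distinct, and then
  \<open>n\<close> independent draws from them are exactly symmetric, and two draws coincide with probability at
  most \<open>1/n\<close>; so \<open>e = 1/n\<close> will do (\<open>resampling_nearly_exchangeable\<close>). Thus the variance given the
  sample is also asymptotic to \<open>n\<^sup>3/36\<close>, with an error bound that does not depend on the sample. The
  ratio of the two variances tends to 1, and after division by \<open>\<sigma>\<^sub>n\<^sup>2\<close> their difference is almost surely
  below a deterministic null sequence.
\<close>

section \<open>Counting inversions\<close>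

definition inversions :: "nat \<Rightarrow> (nat \<Rightarrow> real) \<Rightarrow> real" where
  "inversions n x = (\<Sum>i\<in>{1..n}. \<Sum>j\<in>{1..n}. of_bool (j < i) * of_bool (x i < x j))"

lemma U_Ken_eq_inversions: "U_Ken n x = inversions n x / (real n * (real n - 1))"
proof -
  have "(\<Sum>j\<in>{1..n} - {i}. of_bool (j < i) * of_bool (x j > x i)) =
        (\<Sum>j\<in>{1..n}. of_bool (j < i) * of_bool (x i < x j) :: real)" for i
    by (rule sum.mono_neutral_left) auto
  thus ?thesis by (simp add: U_Ken_def inversions_def)
qed

lemma sum_squares_centred: "(\<Sum>m\<in>{1..n}. (2 * real m - real n - 1)\<^sup>2) = real n * ((real n)\<^sup>2 - 1) / 3"
proof -
  have s1: "(\<Sum>m\<in>{1..n}. real m) = real n * (real n + 1) / 2"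
    by (induction n) (auto simp: field_simps)
  have s2: "(\<Sum>m\<in>{1..n}. (real m)\<^sup>2) = real n * (real n + 1) * (2 * real n + 1) / 6"
    by (induction n) (auto simp: field_simps power2_eq_square)
  have "(\<Sum>m\<in>{1..n}. (2 * real m - real n - 1)\<^sup>2) =
        (\<Sum>m\<in>{1..n}. 4 * (real m)\<^sup>2 - 4 * (real n + 1) * real m + (real n + 1)\<^sup>2)"
    by (rule sum.cong) (auto simp: power2_eq_square algebra_simps)
  also have "\<dots> = 4 * (\<Sum>m\<in>{1..n}. (real m)\<^sup>2) - 4 * (real n + 1) * (\<Sum>m\<in>{1..n}. real m) + real n * (real n + 1)\<^sup>2"
    by (simp add: sum.distrib sum_subtractf sum_distrib_left)
  also have "\<dots> = real n * ((real n)\<^sup>2 - 1) / 3"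
    unfolding s1 s2 by (simp add: field_simps power2_eq_square)
  finally show ?thesis .
qed

text \<open>The covariance of \<open>Y\<^sub>i - Y\<^sub>j\<close> and \<open>Y\<^sub>k - Y\<^sub>l\<close> for uncorrelated \<open>Y\<close> of variance \<open>1/12\<close>, the variance
  of the uniform distribution. In the continuous i.i.d. case it is, for \<open>i \<noteq> j\<close>, \<open>k \<noteq> l\<close> and
  \<open>{i, j} \<noteq> {k, l}\<close>, the covariance of the indicators of \<open>X\<^sub>i < X\<^sub>j\<close> and \<open>X\<^sub>k < X\<^sub>l\<close>: the Hajek
  projection replaces the indicator by \<open>F(X\<^sub>j) - F(X\<^sub>i)\<close> up to a constant.\<close>

definition cov_limit :: "nat \<Rightarrow> nat \<Rightarrow> nat \<Rightarrow> nat \<Rightarrow> real" where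
  "cov_limit i j k l = (of_bool (i = k) + of_bool (j = l) - of_bool (i = l) - of_bool (j = k)) / 12"

lemma cov_limit_eq_sum:
  assumes "i \<in> {1..n}" "j \<in> {1..n}"
  shows "cov_limit i j k l = (\<Sum>m\<in>{1..n}. (of_bool (m = i) - of_bool (m = j)) * (of_bool (m = k) - of_bool (m = l))) / 12"
proof -
  have d: "(\<Sum>m\<in>{1..n}. of_bool (m = a) * of_bool (m = b)) = (of_bool (a = b) :: real)" if "a \<in> {1..n}" for a b
  proof -
    have "(\<Sum>m\<in>{1..n}. of_bool (m = a) * of_bool (m = b)) = (\<Sum>m\<in>{1..n}. if m = a then of_bool (a = b) else (0::real))"
      by (rule sum.cong) auto
    thus ?thesis using that by simp
  qed
  show ?thesis
    using d[OF assms(1), of k] d[OF assms(1), of l] d[OF assms(2), of k] d[OF assms(2), of l]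
    unfolding cov_limit_def
    by (simp add: algebra_simps sum.distrib sum_subtractf)
qed

lemma sum_rotate3:
  "(\<Sum>i\<in>A. \<Sum>j\<in>B. \<Sum>m\<in>C. f i j m) = (\<Sum>m\<in>C. \<Sum>i\<in>A. \<Sum>j\<in>B. f i j m)"
proof -
  have "(\<Sum>i\<in>A. \<Sum>j\<in>B. \<Sum>m\<in>C. f i j m) = (\<Sum>i\<in>A. \<Sum>m\<in>C. \<Sum>j\<in>B. f i j m)"
    by (intro sum.cong refl sum.swap)
  also have "\<dots> = (\<Sum>m\<in>C. \<Sum>i\<in>A. \<Sum>j\<in>B. f i j m)"
    by (rule sum.swap)
  finally show ?thesis .
qed

lemma sum_rotate5:
  "(\<Sum>i\<in>A. \<Sum>j\<in>B. \<Sum>k\<in>C. \<Sum>l\<in>D. \<Sum>m\<in>E. f i j k l m) = (\<Sum>m\<in>E. \<Sum>i\<in>A. \<Sum>j\<in>B. \<Sum>k\<in>C. \<Sum>l\<in>D. f i j k l m)"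
proof -
  have "(\<Sum>i\<in>A. \<Sum>j\<in>B. \<Sum>k\<in>C. \<Sum>l\<in>D. \<Sum>m\<in>E. f i j k l m) = (\<Sum>i\<in>A. \<Sum>j\<in>B. \<Sum>m\<in>E. \<Sum>k\<in>C. \<Sum>l\<in>D. f i j k l m)"
    by (intro sum.cong refl sum_rotate3)
  also have "\<dots> = (\<Sum>m\<in>E. \<Sum>i\<in>A. \<Sum>j\<in>B. \<Sum>k\<in>C. \<Sum>l\<in>D. f i j k l m)"
    by (rule sum_rotate3)
  finally show ?thesis .
qed

text \<open>The sum is the variance of \<open>\<Sum>\<^sub>m d\<^sub>m Y\<^sub>m\<close>, the sum of \<open>Y\<^sub>i - Y\<^sub>j\<close> over all \<open>j < i\<close>. The coefficient of
  \<open>Y\<^sub>m\<close> is \<open>d\<^sub>m = (m - 1) - (n - m)\<close>, which leaves a sum of squares.\<close>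

lemma sum_cov_limit:
  "(\<Sum>i\<in>{1..n}. \<Sum>j\<in>{1..n}. \<Sum>k\<in>{1..n}. \<Sum>l\<in>{1..n}. of_bool (j < i) * of_bool (l < k) * cov_limit i j k l)
   = real n * ((real n)\<^sup>2 - 1) / 36"
proof -
  let ?I = "{1..n}"
  define v where "v m i j = (of_bool (m = i) - of_bool (m = j) :: real)" for m i j :: nat
  define d where "d m = (\<Sum>i\<in>?I. \<Sum>j\<in>?I. of_bool (j < i) * v m i j)" for m
  have cl: "cov_limit i j k l = (\<Sum>m\<in>?I. v m i j * v m k l) / 12" if "i \<in> ?I" "j \<in> ?I" for i j k l
    using cov_limit_eq_sum[OF that] unfolding v_def by simp
  have "(\<Sum>i\<in>?I. \<Sum>j\<in>?I. \<Sum>k\<in>?I. \<Sum>l\<in>?I. of_bool (j < i) * of_bool (l < k) * cov_limit i j k l)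
      = (\<Sum>i\<in>?I. \<Sum>j\<in>?I. \<Sum>k\<in>?I. \<Sum>l\<in>?I. \<Sum>m\<in>?I. (of_bool (j < i) * v m i j) * (of_bool (l < k) * v m k l) / 12)"
    by (intro sum.cong refl) (simp add: cl sum_distrib_left sum_divide_distrib ac_simps)
  also have "\<dots> = (\<Sum>m\<in>?I. \<Sum>i\<in>?I. \<Sum>j\<in>?I. \<Sum>k\<in>?I. \<Sum>l\<in>?I. (of_bool (j < i) * v m i j) * (of_bool (l < k) * v m k l) / 12)"
    by (rule sum_rotate5)
  also have "\<dots> = (\<Sum>m\<in>?I. (d m)\<^sup>2 / 12)"
  proof (rule sum.cong[OF refl])
    fix m
    have "d m * d m / 12 = (\<Sum>i\<in>?I. \<Sum>j\<in>?I. (of_bool (j < i) * v m i j) * d m / 12)"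
      by (subst d_def) (simp only: sum_distrib_right sum_divide_distrib)
    also have "\<dots> = (\<Sum>i\<in>?I. \<Sum>j\<in>?I. \<Sum>k\<in>?I. \<Sum>l\<in>?I. (of_bool (j < i) * v m i j) * (of_bool (l < k) * v m k l) / 12)"
      unfolding d_def by (simp only: sum_distrib_left sum_divide_distrib)
    finally show "(\<Sum>i\<in>?I. \<Sum>j\<in>?I. \<Sum>k\<in>?I. \<Sum>l\<in>?I. (of_bool (j < i) * v m i j) * (of_bool (l < k) * v m k l) / 12) = (d m)\<^sup>2 / 12"
      by (simp add: power2_eq_square)
  qed
  also have "\<dots> = (\<Sum>m\<in>?I. (2 * real m - real n - 1)\<^sup>2 / 12)"
  proof (rule sum.cong[OF refl])
    fix m assume m: "m \<in> ?I"
    have "(\<Sum>i\<in>?I. \<Sum>j\<in>?I. of_bool (j < i) * of_bool (m = i)) = (\<Sum>i\<in>?I. if i = m then (\<Sum>j\<in>?I. of_bool (j < m)) else (0::real))"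
      by (intro sum.cong refl) auto
    also have "\<dots> = (\<Sum>j\<in>?I. of_bool (j < m))" using m by simp
    also have "\<dots> = card (?I \<inter> {j. j < m})" by (subst sum_of_bool_eq) auto
    also have "?I \<inter> {j. j < m} = {1..<m}" using m by auto
    finally have a: "(\<Sum>i\<in>?I. \<Sum>j\<in>?I. of_bool (j < i) * of_bool (m = i)) = real m - 1"
      using m by (simp add: of_nat_diff)
    have "(\<Sum>i\<in>?I. \<Sum>j\<in>?I. of_bool (j < i) * of_bool (m = j)) = (\<Sum>i\<in>?I. \<Sum>j\<in>?I. if j = m then of_bool (m < i) else (0::real))"
      by (intro sum.cong refl) auto
    also have "\<dots> = (\<Sum>i\<in>?I. of_bool (m < i))" using m by simp
    also have "\<dots> = card (?I \<inter> {i. m < i})" by (subst sum_of_bool_eq) auto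
    also have "?I \<inter> {i. m < i} = {m<..n}" using m by auto
    finally have b: "(\<Sum>i\<in>?I. \<Sum>j\<in>?I. of_bool (j < i) * of_bool (m = j)) = real n - real m"
      using m by (simp add: of_nat_diff)
    have "d m = 2 * real m - real n - 1"
      using a b unfolding d_def v_def by (simp add: algebra_simps sum_subtractf)
    thus "(d m)\<^sup>2 / 12 = (2 * real m - real n - 1)\<^sup>2 / 12" by simp
  qed
  also have "\<dots> = real n * ((real n)\<^sup>2 - 1) / 36"
    using sum_squares_centred[of n] by (simp flip: sum_divide_distrib)
  finally show ?thesis .
qed

section \<open>Orders of independent observations\<close>

context prob_space
begin

text \<open>The two strict orders are disjoint and cover everything but the ties, so symmetry makes each of
  them half.\<close>

lemma order_pair_probs:
  assumes [measurable]: "random_variable borel U" "random_variable borel V"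
    and sym: "\<bar>\<P>(\<omega> in M. U \<omega> < V \<omega>) - \<P>(\<omega> in M. V \<omega> < U \<omega>)\<bar> \<le> (e::real)"
    and tie: "\<P>(\<omega> in M. U \<omega> = V \<omega>) \<le> e"
  shows "\<bar>\<P>(\<omega> in M. U \<omega> < (V \<omega> :: real)) - 1/2\<bar> \<le> e"
proof -
  let ?A = "{\<omega>\<in>space M. U \<omega> < V \<omega>}" and ?B = "{\<omega>\<in>space M. V \<omega> < U \<omega>}" and ?T = "{\<omega>\<in>space M. U \<omega> = V \<omega>}"
  have [measurable]: "?A \<in> events" "?B \<in> events" "?T \<in> events" by measurable
  have "prob (?A \<union> ?B) = prob ?A + prob ?B"
    by (rule finite_measure_Union) auto
  moreover have "prob (?A \<union> ?B \<union> ?T) \<le> prob (?A \<union> ?B) + prob ?T"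
    by (rule measure_Un_le) auto
  moreover have "?A \<union> ?B \<union> ?T = space M" by auto
  moreover have "prob (?A \<union> ?B) \<le> 1" by simp
  ultimately show ?thesis using sym tie prob_space by (simp add: abs_le_iff)
qed

text \<open>Up to ties, exactly one of the three variables is the smallest, so near-symmetry gives \<open>1/3\<close> for the
  minimum. Inclusion-exclusion turns this into the probability that \<open>U\<close> is the largest,
  and subtracting from \<open>P(U < V)\<close> the case that \<open>U\<close> is the smallest leaves \<open>1/6\<close> for the order
  \<open>W < U < V\<close>.\<close>

lemma order_triple_probs:
  fixes U V W :: "'a \<Rightarrow> real"
  assumes [measurable]: "random_variable borel U" "random_variable borel V" "random_variable borel W"
    and UV: "\<bar>\<P>(\<omega> in M. U \<omega> < V \<omega> \<and> U \<omega> < W \<omega>) - \<P>(\<omega> in M. V \<omega> < U \<omega> \<and> V \<omega> < W \<omega>)\<bar> \<le> e"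
    and UW: "\<bar>\<P>(\<omega> in M. U \<omega> < V \<omega> \<and> U \<omega> < W \<omega>) - \<P>(\<omega> in M. W \<omega> < U \<omega> \<and> W \<omega> < V \<omega>)\<bar> \<le> e"
    and tUV: "\<P>(\<omega> in M. U \<omega> = V \<omega>) \<le> e"
    and tUW: "\<P>(\<omega> in M. U \<omega> = W \<omega>) \<le> e"
    and tVW: "\<P>(\<omega> in M. V \<omega> = W \<omega>) \<le> e"
    and p1: "\<bar>\<P>(\<omega> in M. U \<omega> < V \<omega>) - 1/2\<bar> \<le> e"
    and p2: "\<bar>\<P>(\<omega> in M. V \<omega> < U \<omega>) - 1/2\<bar> \<le> e"
    and p3: "\<bar>\<P>(\<omega> in M. W \<omega> < U \<omega>) - 1/2\<bar> \<le> e"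
  shows "\<bar>\<P>(\<omega> in M. U \<omega> < V \<omega> \<and> U \<omega> < W \<omega>) - 1/3\<bar> \<le> 6 * e"
    and "\<bar>\<P>(\<omega> in M. V \<omega> < U \<omega> \<and> W \<omega> < U \<omega>) - 1/3\<bar> \<le> 6 * e"
    and "\<bar>\<P>(\<omega> in M. U \<omega> < V \<omega> \<and> W \<omega> < U \<omega>) - 1/6\<bar> \<le> 6 * e"
proof -
  let ?A = "{\<omega>\<in>space M. U \<omega> < V \<omega> \<and> U \<omega> < W \<omega>}" and ?B = "{\<omega>\<in>space M. V \<omega> < U \<omega> \<and> V \<omega> < W \<omega>}"
  let ?C = "{\<omega>\<in>space M. W \<omega> < U \<omega> \<and> W \<omega> < V \<omega>}"
  let ?T1 = "{\<omega>\<in>space M. U \<omega> = V \<omega>}" and ?T2 = "{\<omega>\<in>space M. U \<omega> = W \<omega>}" and ?T3 = "{\<omega>\<in>space M. V \<omega> = W \<omega>}"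
  let ?D = "{\<omega>\<in>space M. V \<omega> < U \<omega> \<and> W \<omega> < U \<omega>}"
  let ?E = "{\<omega>\<in>space M. U \<omega> < V \<omega> \<and> W \<omega> < U \<omega>}"
  let ?VU = "{\<omega>\<in>space M. V \<omega> < U \<omega>}" and ?UV = "{\<omega>\<in>space M. U \<omega> < V \<omega>}" and ?WU = "{\<omega>\<in>space M. W \<omega> < U \<omega>}"
  have e: "e \<ge> 0" using tUV measure_nonneg order_trans by blast
  have [measurable]: "?A \<in> events" "?B \<in> events" "?C \<in> events" "?T1 \<in> events" "?T2 \<in> events" "?T3 \<in> events"
     "?D \<in> events" "?E \<in> events" "?VU \<in> events" "?UV \<in> events" "?WU \<in> events" by measurable
  have s1: "prob (?A \<union> ?B) = prob ?A + prob ?B" by (rule finite_measure_Union) auto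
  have s2: "prob (?A \<union> ?B \<union> ?C) = prob (?A \<union> ?B) + prob ?C" by (rule finite_measure_Union) auto
  have s3: "prob (?A \<union> ?B \<union> ?C) \<le> 1" by simp
  have s4: "prob (?T1 \<union> ?T2) \<le> prob ?T1 + prob ?T2" by (rule measure_Un_le) auto
  have s5: "prob (?T1 \<union> ?T2 \<union> ?T3) \<le> prob (?T1 \<union> ?T2) + prob ?T3" by (rule measure_Un_le) auto
  have s6: "prob ((?A \<union> ?B \<union> ?C) \<union> (?T1 \<union> ?T2 \<union> ?T3)) \<le> prob (?A \<union> ?B \<union> ?C) + prob (?T1 \<union> ?T2 \<union> ?T3)"
    by (rule measure_Un_le) auto
  have s7: "(?A \<union> ?B \<union> ?C) \<union> (?T1 \<union> ?T2 \<union> ?T3) = space M" by auto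
  have min: "\<bar>3 * prob ?A - 1\<bar> \<le> 5 * e"
    using s1 s2 s3 s4 s5 s6 s7 UV UW tUV tUW tVW prob_space by (simp add: abs_le_iff)
  show "\<bar>prob ?A - 1/3\<bar> \<le> 6 * e" using min e by (simp add: abs_le_iff)
  have m1: "prob (?VU \<union> ?WU) = prob ?VU + prob ?WU - prob ?D"
  proof -
    have "prob (?VU \<union> ?WU) = prob ?VU + prob (?WU - ?VU)"
      by (rule finite_measure_Union') auto
    moreover have "prob ?WU = prob (?WU - ?VU) + prob ?D"
      by (subst finite_measure_Union[symmetric]) (auto intro!: arg_cong[where f=prob])
    ultimately show ?thesis by simp
  qed
  have m2: "prob ((?VU \<union> ?WU) \<union> ?A) = prob (?VU \<union> ?WU) + prob ?A"
    by (rule finite_measure_Union) auto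
  have m3: "prob ((?VU \<union> ?WU) \<union> ?A) \<le> 1" by simp
  have m4: "prob (((?VU \<union> ?WU) \<union> ?A) \<union> (?T1 \<union> ?T2)) \<le> prob ((?VU \<union> ?WU) \<union> ?A) + prob (?T1 \<union> ?T2)"
    by (rule measure_Un_le) auto
  have m5: "((?VU \<union> ?WU) \<union> ?A) \<union> (?T1 \<union> ?T2) = space M" by auto
  show "\<bar>prob ?D - 1/3\<bar> \<le> 6 * e"
    using m1 m2 m3 m4 m5 s4 min p2 p3 tUV tUW prob_space e by (simp add: abs_le_iff)
  have k1: "prob (?A \<union> ?E) = prob ?A + prob ?E" by (rule finite_measure_Union) auto
  have k2: "prob (?A \<union> ?E) \<le> prob ?UV" by (rule finite_measure_mono) auto
  have k3: "prob ?UV \<le> prob ((?A \<union> ?E) \<union> ?T2)" by (rule finite_measure_mono) auto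
  have k4: "prob ((?A \<union> ?E) \<union> ?T2) \<le> prob (?A \<union> ?E) + prob ?T2" by (rule measure_Un_le) auto
  show "\<bar>prob ?E - 1/6\<bar> \<le> 6 * e"
    using k1 k2 k3 k4 min p1 tUW e by (simp add: abs_le_iff)
qed

text \<open>The pairs may be degenerate, \<open>i = j\<close> or \<open>k = l\<close>. This matters because both members of an
  independent pair of variables take values in the same space: a single variable that is to be
  compared with a pair enters as \<open>(X\<^sub>j, X\<^sub>j)\<close>.\<close>

lemma indep_var_pairs:
  assumes ind: "indep_vars (\<lambda>_. borel) X I" and I: "i \<in> I" "j \<in> I" "k \<in> I" "l \<in> I"
    and disj: "{i, j} \<inter> {k, l} = {}"
  shows "indep_var (borel \<Otimes>\<^sub>M borel) (\<lambda>\<omega>. (X i \<omega>, X j \<omega>)) (borel \<Otimes>\<^sub>M borel) (\<lambda>\<omega>. (X k \<omega>, X l \<omega>))"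
proof -
  have "indep_var (PiM {i,j} (\<lambda>_. borel)) (\<lambda>\<omega>. restrict (\<lambda>i. X i \<omega>) {i,j})
                  (PiM {k,l} (\<lambda>_. borel)) (\<lambda>\<omega>. restrict (\<lambda>i. X i \<omega>) {k,l})"
    using I by (intro indep_var_restrict[OF ind disj]) auto
  hence "indep_var (borel \<Otimes>\<^sub>M borel) ((\<lambda>f. (f i, f j)) \<circ> (\<lambda>\<omega>. restrict (\<lambda>i. X i \<omega>) {i,j}))
                  (borel \<Otimes>\<^sub>M borel) ((\<lambda>f. (f k, f l)) \<circ> (\<lambda>\<omega>. restrict (\<lambda>i. X i \<omega>) {k,l}))"
    by (rule indep_var_compose) (auto intro!: measurable_Pair measurable_component_singleton)
  thus ?thesis by (simp add: comp_def)
qed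

lemma prob_indep_orders:
  fixes X :: "nat \<Rightarrow> 'a \<Rightarrow> real"
  assumes ind: "indep_vars (\<lambda>_. borel) X I" and I: "i \<in> I" "j \<in> I" "k \<in> I" "l \<in> I"
    and disj: "{i, j} \<inter> {k, l} = {}"
  shows "\<P>(\<omega> in M. X i \<omega> < X j \<omega> \<and> X k \<omega> < X l \<omega>) = \<P>(\<omega> in M. X i \<omega> < X j \<omega>) * \<P>(\<omega> in M. X k \<omega> < X l \<omega>)"
proof -
  have "{x \<in> space (borel \<Otimes>\<^sub>M borel). fst x < (snd x :: real)} \<in> sets (borel \<Otimes>\<^sub>M borel)"
    by measurable
  hence L: "{x::real\<times>real. fst x < snd x} \<in> sets (borel \<Otimes>\<^sub>M borel)"
    by (simp add: space_pair_measure)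
  show ?thesis
    using prob_indep_random_variable[OF indep_var_pairs[OF ind I disj] L L] by simp
qed

end

section \<open>The variance of the number of inversions\<close>

text \<open>Both the observed and the bootstrap sample are of this kind. The conditions compare probabilities
  under a swap of two observations and do not prescribe their values: the values
  \<open>1/2\<close> and \<open>1/3\<close> follow, since the orders that are being swapped exhaust all possibilities up to ties.\<close>

locale nearly_exchangeable = prob_space +
  fixes n :: nat and X :: "nat \<Rightarrow> 'a \<Rightarrow> real" and e :: real
  assumes indep: "indep_vars (\<lambda>_. borel) X {1..n}"
    and swap_pair: "\<And>i j. i \<in> {1..n} \<Longrightarrow> j \<in> {1..n} \<Longrightarrow> i \<noteq> j \<Longrightarrow>
      \<bar>\<P>(\<omega> in M. X i \<omega> < X j \<omega>) - \<P>(\<omega> in M. X j \<omega> < X i \<omega>)\<bar> \<le> e"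
    and swap_min: "\<And>i j k. i \<in> {1..n} \<Longrightarrow> j \<in> {1..n} \<Longrightarrow> k \<in> {1..n} \<Longrightarrow> distinct [i, j, k] \<Longrightarrow>
      \<bar>\<P>(\<omega> in M. X i \<omega> < X j \<omega> \<and> X i \<omega> < X k \<omega>) - \<P>(\<omega> in M. X j \<omega> < X i \<omega> \<and> X j \<omega> < X k \<omega>)\<bar> \<le> e"
    and ties: "\<And>i j. i \<in> {1..n} \<Longrightarrow> j \<in> {1..n} \<Longrightarrow> i \<noteq> j \<Longrightarrow> \<P>(\<omega> in M. X i \<omega> = X j \<omega>) \<le> e"
    and e_nonneg: "0 \<le> e"
begin

definition "less_prob i j = \<P>(\<omega> in M. X i \<omega> < X j \<omega>)"
definition "less_less_prob i j k l = \<P>(\<omega> in M. X i \<omega> < X j \<omega> \<and> X k \<omega> < X l \<omega>)"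

lemma rv: "i \<in> {1..n} \<Longrightarrow> random_variable borel (X i)"
  using indep by (auto simp: indep_vars_def)

lemma less_prob_approx:
  assumes "i \<in> {1..n}" "j \<in> {1..n}" "i \<noteq> j"
  shows "\<bar>less_prob i j - 1/2\<bar> \<le> e"
  unfolding less_prob_def using assms by (intro order_pair_probs rv swap_pair ties)

lemma less_less_prob_approx:
  assumes "i \<in> {1..n}" "j \<in> {1..n}" "k \<in> {1..n}" "distinct [i, j, k]"
  shows "\<bar>less_less_prob i j i k - 1/3\<bar> \<le> 6 * e" "\<bar>less_less_prob j i k i - 1/3\<bar> \<le> 6 * e" "\<bar>less_less_prob i j k i - 1/6\<bar> \<le> 6 * e"
proof -
  have d: "i \<noteq> j" "i \<noteq> k" "j \<noteq> k" using assms by auto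
  have UW: "\<bar>\<P>(\<omega> in M. X i \<omega> < X j \<omega> \<and> X i \<omega> < X k \<omega>) - \<P>(\<omega> in M. X k \<omega> < X i \<omega> \<and> X k \<omega> < X j \<omega>)\<bar> \<le> e"
    using swap_min[of i k j] assms by (simp add: conj_commute)
  note * = order_triple_probs[OF rv[OF assms(1)] rv[OF assms(2)] rv[OF assms(3)] swap_min[OF assms] UW
    ties[OF assms(1,2)] ties[OF assms(1,3)] ties[OF assms(2,3)]
    less_prob_approx[OF assms(1,2), unfolded less_prob_def] less_prob_approx[OF assms(2,1), unfolded less_prob_def]
    less_prob_approx[OF assms(3,1), unfolded less_prob_def]]
  show "\<bar>less_less_prob i j i k - 1/3\<bar> \<le> 6 * e" "\<bar>less_less_prob j i k i - 1/3\<bar> \<le> 6 * e" "\<bar>less_less_prob i j k i - 1/6\<bar> \<le> 6 * e"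
    unfolding less_less_prob_def using d by (intro *; simp)+
qed

lemma less_prob_bounds: "0 \<le> less_prob i j" "less_prob i j \<le> 1"
  unfolding less_prob_def by simp_all

lemma less_prob_prod_approx:
  assumes "i \<in> {1..n}" "j \<in> {1..n}" "i \<noteq> j" "k \<in> {1..n}" "l \<in> {1..n}" "k \<noteq> l"
  shows "\<bar>less_prob i j * less_prob k l - 1/4\<bar> \<le> 2 * e"
proof -
  have "less_prob i j * less_prob k l - 1/4 = (less_prob i j - 1/2) * less_prob k l + (less_prob k l - 1/2) / 2"
    by (simp add: field_simps)
  also have "\<bar>\<dots>\<bar> \<le> \<bar>less_prob i j - 1/2\<bar> * \<bar>less_prob k l\<bar> + \<bar>less_prob k l - 1/2\<bar> / 2"
    by (metis abs_triangle_ineq abs_mult abs_divide abs_numeral)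
  also have "\<dots> \<le> e * 1 + e / 2"
    using less_prob_approx[OF assms(1-3)] less_prob_approx[OF assms(4-6)] less_prob_bounds[of k l] e_nonneg
    by (intro add_mono mult_mono) auto
  finally show ?thesis using e_nonneg by simp
qed

text \<open>The cases follow the shared index. If it plays the same role in both events, they say together that
  it carries the minimum or the maximum of three observations, and the covariance is near
  \<open>1/3 - 1/4 = 1/12\<close>; if it plays opposite roles, it carries the middle one, and the covariance is
  near \<open>1/6 - 1/4 = -1/12\<close>. For equal events the bound 1 suffices, because there are only \<open>O(n\<^sup>2)\<close> of
  them.\<close>

lemma order_covariance_approx:
  assumes I: "i \<in> {1..n}" "j \<in> {1..n}" "k \<in> {1..n}" "l \<in> {1..n}" and less: "j < i" "l < k"
  shows "\<bar>less_less_prob i j k l - less_prob i j * less_prob k l - cov_limit i j k l\<bar> \<le>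
     8 * e * (of_bool (i = k) + of_bool (j = l) + of_bool (i = l) + of_bool (j = k)) + of_bool (i = k) * of_bool (j = l)"
proof -
  have p: "\<bar>less_prob i j * less_prob k l - 1/4\<bar> \<le> 2 * e" using assms by (intro less_prob_prod_approx) auto
  consider "i = k" "j = l" | "i = k" "j \<noteq> l" | "i \<noteq> k" "j = l" | "i = l" | "j = k" | "{i, j} \<inter> {k, l} = {}"
    by auto
  thus ?thesis
  proof cases
    case 1
    define q where "q = less_prob i j * less_prob i j"
    have "less_less_prob i j i j = less_prob i j" unfolding less_less_prob_def less_prob_def by simp
    moreover have "0 \<le> q" unfolding q_def by simp
    moreover have "q \<le> less_prob i j" unfolding q_def using less_prob_bounds[of i j] by (simp add: mult_left_le)
    ultimately show ?thesis using 1 less less_prob_bounds[of i j] e_nonneg q_def[symmetric]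
      by (simp add: cov_limit_def abs_le_iff)
  next
    case 2
    have "\<bar>less_less_prob i j i l - 1/3\<bar> \<le> 6 * e" using 2 assms by (intro less_less_prob_approx) auto
    thus ?thesis using 2 p less by (simp add: cov_limit_def abs_le_iff)
  next
    case 3
    have "\<bar>less_less_prob i j k j - 1/3\<bar> \<le> 6 * e" using 3 assms by (intro less_less_prob_approx) auto
    thus ?thesis using 3 p less by (simp add: cov_limit_def abs_le_iff)
  next
    case 4
    have "\<bar>less_less_prob i j k i - 1/6\<bar> \<le> 6 * e" using 4 assms by (intro less_less_prob_approx) auto
    thus ?thesis using 4 p less by (simp add: cov_limit_def abs_le_iff)
  next
    case 5
    have "\<bar>less_less_prob j l i j - 1/6\<bar> \<le> 6 * e" using 5 assms by (intro less_less_prob_approx) auto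
    moreover have "less_less_prob j l i j = less_less_prob i j j l" unfolding less_less_prob_def by (simp add: conj_commute)
    ultimately show ?thesis using 5 p less by (simp add: cov_limit_def abs_le_iff)
  next
    case 6
    have "less_less_prob i j k l = less_prob i j * less_prob k l"
      unfolding less_less_prob_def less_prob_def by (rule prob_indep_orders[OF indep I 6])
    thus ?thesis using 6 e_nonneg by (auto simp: cov_limit_def)
  qed
qed

lemma variance_inversions_eq:
  "variance (\<lambda>\<omega>. inversions n (\<lambda>i. X i \<omega>)) =
   (\<Sum>i\<in>{1..n}. \<Sum>j\<in>{1..n}. \<Sum>k\<in>{1..n}. \<Sum>l\<in>{1..n}.
      of_bool (j < i) * of_bool (l < k) * (less_less_prob i j k l - less_prob i j * less_prob k l))"
proof -
  let ?I = "{1..n}"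
  define b where "b i j \<omega> = (of_bool (X i \<omega> < X j \<omega>) :: real)" for i j \<omega>
  have int1: "integrable M (b i j)" if "i \<in> ?I" "j \<in> ?I" for i j
    using rv[OF that(1)] rv[OF that(2)] unfolding b_def
    by (auto intro!: integrable_const_bound[where B = 1])
  have int2: "integrable M (\<lambda>\<omega>. b i j \<omega> * b k l \<omega>)"
    if "i \<in> ?I" "j \<in> ?I" "k \<in> ?I" "l \<in> ?I" for i j k l
    using rv[OF that(1)] rv[OF that(2)] rv[OF that(3)] rv[OF that(4)] unfolding b_def
    by (auto intro!: integrable_const_bound[where B = 1])
  note int = int1 int2
  have Eb: "expectation (b i j) = less_prob i j" if "i \<in> ?I" "j \<in> ?I" for i j
  proof -
    have "expectation (b i j) = expectation (indicator {\<omega>\<in>space M. X i \<omega> < X j \<omega>})"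
      unfolding b_def by (intro Bochner_Integration.integral_cong) auto
    thus ?thesis using rv[OF that(1)] rv[OF that(2)] by (simp add: less_prob_def)
  qed
  have Ebb: "expectation (\<lambda>\<omega>. b i j \<omega> * b k l \<omega>) = less_less_prob i j k l"
    if "i \<in> ?I" "j \<in> ?I" "k \<in> ?I" "l \<in> ?I" for i j k l
  proof -
    have "expectation (\<lambda>\<omega>. b i j \<omega> * b k l \<omega>) = expectation (indicator {\<omega>\<in>space M. X i \<omega> < X j \<omega> \<and> X k \<omega> < X l \<omega>})"
      unfolding b_def by (intro Bochner_Integration.integral_cong) auto
    thus ?thesis using rv[OF that(1)] rv[OF that(2)] rv[OF that(3)] rv[OF that(4)] by (simp add: less_less_prob_def)
  qed
  have sq: "(\<Sum>i\<in>?I. \<Sum>j\<in>?I. F i j) * (\<Sum>k\<in>?I. \<Sum>l\<in>?I. F k l) = (\<Sum>i\<in>?I. \<Sum>j\<in>?I. \<Sum>k\<in>?I. \<Sum>l\<in>?I. F i j * F k l)"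
    for F :: "nat \<Rightarrow> nat \<Rightarrow> real"
    by (subst sum_distrib_right, subst sum_distrib_right) (simp only: sum_distrib_left)
  have inv: "inversions n (\<lambda>i. X i \<omega>) = (\<Sum>i\<in>?I. \<Sum>j\<in>?I. of_bool (j < i) * b i j \<omega>)" for \<omega>
    unfolding inversions_def b_def ..
  have inv2: "(inversions n (\<lambda>i. X i \<omega>))\<^sup>2 = (\<Sum>i\<in>?I. \<Sum>j\<in>?I. \<Sum>k\<in>?I. \<Sum>l\<in>?I.
      of_bool (j < i) * of_bool (l < k) * (b i j \<omega> * b k l \<omega>))" for \<omega>
    unfolding inv power2_eq_square sq by (intro sum.cong refl) (simp add: ac_simps)
  have E1: "expectation (\<lambda>\<omega>. inversions n (\<lambda>i. X i \<omega>)) = (\<Sum>i\<in>?I. \<Sum>j\<in>?I. of_bool (j < i) * less_prob i j)"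
    unfolding inv
    by (subst Bochner_Integration.integral_sum, (intro Bochner_Integration.integrable_sum integrable_mult_right int; assumption),
        rule sum.cong[OF refl])+ (simp add: Eb)
  have E2: "expectation (\<lambda>\<omega>. (inversions n (\<lambda>i. X i \<omega>))\<^sup>2) =
     (\<Sum>i\<in>?I. \<Sum>j\<in>?I. \<Sum>k\<in>?I. \<Sum>l\<in>?I. of_bool (j < i) * of_bool (l < k) * less_less_prob i j k l)"
  proof -
    note [simp] = int Ebb
    show ?thesis unfolding inv2
      by (subst Bochner_Integration.integral_sum, (intro Bochner_Integration.integrable_sum integrable_mult_right int; assumption),
          rule sum.cong[OF refl])+ simp
  qed
  have "variance (\<lambda>\<omega>. inversions n (\<lambda>i. X i \<omega>)) =
     expectation (\<lambda>\<omega>. (inversions n (\<lambda>i. X i \<omega>))\<^sup>2) - (expectation (\<lambda>\<omega>. inversions n (\<lambda>i. X i \<omega>)))\<^sup>2"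
  proof (rule variance_eq)
    show "integrable M (\<lambda>\<omega>. inversions n (\<lambda>i. X i \<omega>))"
      unfolding inv by (intro Bochner_Integration.integrable_sum integrable_mult_right int)
    show "integrable M (\<lambda>\<omega>. (inversions n (\<lambda>i. X i \<omega>))\<^sup>2)"
      unfolding inv2 by (intro Bochner_Integration.integrable_sum integrable_mult_right int)
  qed
  also have "\<dots> = (\<Sum>i\<in>?I. \<Sum>j\<in>?I. \<Sum>k\<in>?I. \<Sum>l\<in>?I.
      of_bool (j < i) * of_bool (l < k) * less_less_prob i j k l - (of_bool (j < i) * less_prob i j) * (of_bool (l < k) * less_prob k l))"
    unfolding E1 E2 unfolding power2_eq_square sq by (simp only: sum_subtractf)
  also have "\<dots> = (\<Sum>i\<in>?I. \<Sum>j\<in>?I. \<Sum>k\<in>?I. \<Sum>l\<in>?I.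
      of_bool (j < i) * of_bool (l < k) * (less_less_prob i j k l - less_prob i j * less_prob k l))"
    by (intro sum.cong refl) (simp add: algebra_simps)
  finally show ?thesis .
qed

text \<open>Summing the covariance errors: fixing one coincidence of indices leaves at most \<open>n\<^sup>3\<close>
  quadruples, and there are four possible coincidences.\<close>

theorem variance_inversions_approx:
  "\<bar>variance (\<lambda>\<omega>. inversions n (\<lambda>i. X i \<omega>)) - real n * ((real n)\<^sup>2 - 1) / 36\<bar> \<le> 32 * e * real n ^ 3 + (real n)\<^sup>2"
proof -
  let ?I = "{1..n}"
  have diff: "(\<Sum>i\<in>?I. \<Sum>j\<in>?I. \<Sum>k\<in>?I. \<Sum>l\<in>?I. of_bool (j < i) * of_bool (l < k) * (F i j k l - G i j k l)) =
      (\<Sum>i\<in>?I. \<Sum>j\<in>?I. \<Sum>k\<in>?I. \<Sum>l\<in>?I. of_bool (j < i) * of_bool (l < k) * F i j k l) -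
      (\<Sum>i\<in>?I. \<Sum>j\<in>?I. \<Sum>k\<in>?I. \<Sum>l\<in>?I. of_bool (j < i) * of_bool (l < k) * G i j k l)"
    for F G :: "nat \<Rightarrow> nat \<Rightarrow> nat \<Rightarrow> nat \<Rightarrow> real"
    by (simp only: right_diff_distrib sum_subtractf)
  have "\<bar>variance (\<lambda>\<omega>. inversions n (\<lambda>i. X i \<omega>)) - real n * ((real n)\<^sup>2 - 1) / 36\<bar> =
     \<bar>\<Sum>i\<in>?I. \<Sum>j\<in>?I. \<Sum>k\<in>?I. \<Sum>l\<in>?I.
      of_bool (j < i) * of_bool (l < k) * (less_less_prob i j k l - less_prob i j * less_prob k l - cov_limit i j k l)\<bar>"
    unfolding variance_inversions_eq sum_cov_limit[symmetric] diff ..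
  also have "\<dots> \<le> (\<Sum>i\<in>?I. \<Sum>j\<in>?I. \<Sum>k\<in>?I. \<Sum>l\<in>?I. \<bar>of_bool (j < i) * of_bool (l < k) * (less_less_prob i j k l - less_prob i j * less_prob k l - cov_limit i j k l)\<bar>)"
    by (intro order_trans[OF sum_abs] sum_mono order_refl)
  also have "\<dots> \<le> (\<Sum>i\<in>?I. \<Sum>j\<in>?I. \<Sum>k\<in>?I. \<Sum>l\<in>?I.
     8 * e * (of_bool (i = k) + of_bool (j = l) + of_bool (i = l) + of_bool (j = k)) + of_bool (i = k) * of_bool (j = l))"
  proof (intro sum_mono)
    fix i j k l assume I: "i \<in> ?I" "j \<in> ?I" "k \<in> ?I" "l \<in> ?I"
    show "\<bar>of_bool (j < i) * of_bool (l < k) * (less_less_prob i j k l - less_prob i j * less_prob k l - cov_limit i j k l)\<bar> \<le>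
     8 * e * (of_bool (i = k) + of_bool (j = l) + of_bool (i = l) + of_bool (j = k)) + of_bool (i = k) * of_bool (j = l)"
    proof (cases "j < i \<and> l < k")
      case True
      thus ?thesis using order_covariance_approx[OF I] by simp
    next
      case False
      thus ?thesis using e_nonneg by auto
    qed
  qed
  also have "\<dots> = 32 * e * real n ^ 3 + (real n)\<^sup>2"
  proof -
    have o: "(\<Sum>l\<in>?I. of_bool (a = l)) = (1::real)" if "a \<in> ?I" for a
      using that by (simp add: of_bool_def)
    show ?thesis
      by (simp add: sum.distrib o flip: sum_distrib_left) (simp add: power2_eq_square power3_eq_cube algebra_simps)
  qed
  finally show ?thesis .
qed

end

section \<open>Conditional probabilities of orders\<close>

lemma (in prob_space) expectation_indep_var_Fubini:
  fixes f :: "'b \<times> 'b \<Rightarrow> real"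
  assumes ind: "indep_var S W T Y"
    and f: "f \<in> borel_measurable (S \<Otimes>\<^sub>M T)" and bound: "\<And>z. \<bar>f z\<bar> \<le> B"
  shows "expectation (\<lambda>\<omega>. f (W \<omega>, Y \<omega>)) = expectation (\<lambda>\<omega>. expectation (\<lambda>\<omega>'. f (W \<omega>, Y \<omega>')))"
proof -
  have W: "random_variable S W" and Y: "random_variable T Y"
    and eq: "distr M S W \<Otimes>\<^sub>M distr M T Y = distr M (S \<Otimes>\<^sub>M T) (\<lambda>\<omega>. (W \<omega>, Y \<omega>))"
    using ind unfolding indep_var_distribution_eq by auto
  interpret S: prob_space "distr M S W" using W by (rule prob_space_distr)
  interpret T: prob_space "distr M T Y" using Y by (rule prob_space_distr)
  interpret P: pair_prob_space "distr M S W" "distr M T Y" ..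
  note [measurable] = W Y f
  have sec: "(\<lambda>y. f (w, y)) \<in> borel_measurable T" if "w \<in> space S" for w
    using that by (intro measurable_compose[OF measurable_Pair1' f])
  have "expectation (\<lambda>\<omega>. f (W \<omega>, Y \<omega>)) = (\<integral>z. f z \<partial>distr M (S \<Otimes>\<^sub>M T) (\<lambda>\<omega>. (W \<omega>, Y \<omega>)))"
    by (subst integral_distr) auto
  also have "\<dots> = (\<integral>z. f z \<partial>(distr M S W \<Otimes>\<^sub>M distr M T Y))" by (simp only: eq)
  also have "\<dots> = (\<integral>w. (\<integral>y. f (w, y) \<partial>distr M T Y) \<partial>distr M S W)"
    using bound f by (intro P.integral_fst'[symmetric] P.P.integrable_const_bound[where B = B]) auto
  also have "\<dots> = (\<integral>w. expectation (\<lambda>\<omega>'. f (w, Y \<omega>')) \<partial>distr M S W)"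
    by (intro Bochner_Integration.integral_cong refl integral_distr Y sec) auto
  also have "\<dots> = expectation (\<lambda>\<omega>. expectation (\<lambda>\<omega>'. f (W \<omega>, Y \<omega>')))"
    by (subst integral_distr) auto
  finally show ?thesis .
qed

context prob_space
begin

definition "survival Y x = \<P>(\<omega> in M. x < (Y \<omega> :: real))"

text \<open>The survival function is a section measure of the measurable set of all \<open>(x, \<omega>)\<close> with
  \<open>x < Y \<omega>\<close>.\<close>

lemma survival_measurable [measurable]:
  assumes [measurable]: "random_variable borel Y"
  shows "survival Y \<in> borel_measurable borel"
proof -
  have "survival Y = (\<lambda>x. measure M {\<omega>\<in>space M. (x, \<omega>) \<in> {z\<in>space (borel \<Otimes>\<^sub>M M). fst z < Y (snd z)}})"
    by (auto simp: survival_def fun_eq_iff space_pair_measure intro!: arg_cong[where f = prob])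
  also have "\<dots> \<in> borel_measurable borel"
    by measurable
  finally show ?thesis .
qed

lemma survival_bounds: "\<bar>survival Y x\<bar> \<le> 1"
  unfolding survival_def by simp

lemma expectation_survival:
  assumes [measurable]: "random_variable borel Y"
  shows "expectation (\<lambda>\<omega>. of_bool (x < Y \<omega>)) = survival Y x"
proof -
  have "expectation (\<lambda>\<omega>. of_bool (x < Y \<omega>) :: real) = expectation (indicator {\<omega>\<in>space M. x < Y \<omega>})"
    by (intro Bochner_Integration.integral_cong) auto
  thus ?thesis by (simp add: survival_def)
qed

text \<open>The observation \<open>X\<^sub>j\<close> can be integrated out first, as it is independent of \<open>(X\<^sub>i, X\<^sub>k)\<close>. Taking for
  \<open>g\<close> an indicator in the first component identifies the conditional probability given \<open>X\<^sub>i\<close>;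
  letting \<open>g\<close> involve \<open>X\<^sub>k\<close> handles triples.\<close>

lemma expectation_order_indep:
  assumes ind: "indep_vars (\<lambda>_. borel) X I" and I: "i \<in> I" "j \<in> I" "k \<in> I" and ne: "j \<notin> {i, k}"
    and g: "g \<in> borel_measurable (borel \<Otimes>\<^sub>M borel)" and bound: "\<And>z. \<bar>g z\<bar> \<le> B"
  shows "expectation (\<lambda>\<omega>. g (X i \<omega>, X k \<omega>) * of_bool (X i \<omega> < X j \<omega>)) =
         expectation (\<lambda>\<omega>. g (X i \<omega>, X k \<omega>) * survival (X j) (X i \<omega>))"
proof -
  note [measurable] = g
  have rv: "random_variable borel (X j)" using ind I by (auto simp: indep_vars_def)
  have iv: "indep_var (borel \<Otimes>\<^sub>M borel) (\<lambda>\<omega>. (X i \<omega>, X k \<omega>)) (borel \<Otimes>\<^sub>M borel) (\<lambda>\<omega>. (X j \<omega>, X j \<omega>))"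
    using ne by (intro indep_var_pairs[OF ind]) (use I in auto)
  define h where "h z = g (fst z) * of_bool (fst (fst z) < fst (snd z))" for z :: "(real \<times> real) \<times> (real \<times> real)"
  have h: "h \<in> borel_measurable ((borel \<Otimes>\<^sub>M borel) \<Otimes>\<^sub>M (borel \<Otimes>\<^sub>M borel))"
    unfolding h_def by measurable
  have hb: "\<bar>h z\<bar> \<le> B" for z
    using bound[of "fst z"] order_trans[OF abs_ge_zero bound] by (auto simp: h_def)
  have "expectation (\<lambda>\<omega>. h ((X i \<omega>, X k \<omega>), (X j \<omega>, X j \<omega>))) =
        expectation (\<lambda>\<omega>. expectation (\<lambda>\<omega>'. h ((X i \<omega>, X k \<omega>), (X j \<omega>', X j \<omega>'))))"
    by (rule expectation_indep_var_Fubini[OF iv h hb])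
  thus ?thesis
    unfolding h_def by (simp add: expectation_survival[OF rv])
qed

lemma cond_prob_given_eq_survival:
  assumes ind: "indep_vars (\<lambda>_. borel) X I" and I: "i \<in> I" "j \<in> I" and ne: "i \<noteq> j"
  shows "AE \<omega> in M. cond_prob_given M (\<lambda>\<omega>. X j \<omega> > X i \<omega>) (X i) \<omega> = survival (X j) (X i \<omega>)"
proof -
  let ?F = "vimage_algebra (space M) (X i) borel"
  have [measurable]: "random_variable borel (X i)" "random_variable borel (X j)"
    using ind I by (auto simp: indep_vars_def)
  have sub: "subalgebra M ?F"
    unfolding subalgebra_def by (auto simp: sets_vimage_algebra2)
  interpret F: finite_measure_subalgebra M ?F
    by unfold_locales (rule sub)
  have XF: "X i \<in> borel_measurable ?F"
    by (rule measurable_vimage_algebra1) auto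
  show ?thesis
    unfolding cond_prob_given_def
  proof (rule F.real_cond_exp_charact)
    fix A assume "A \<in> sets ?F"
    then obtain B where B [measurable]: "B \<in> sets borel" and A: "A = X i -` B \<inter> space M"
      by (auto simp: sets_vimage_algebra2)
    have "expectation (\<lambda>\<omega>. indicator B (fst (X i \<omega>, X i \<omega>)) * of_bool (X i \<omega> < X j \<omega>)) =
          expectation (\<lambda>\<omega>. indicator B (fst (X i \<omega>, X i \<omega>)) * survival (X j) (X i \<omega>))"
      using ne by (intro expectation_order_indep[OF ind I(1,2,1), where B = 1]) (auto simp: indicator_def)
    moreover have "(\<integral>\<omega>\<in>A. f \<omega> \<partial>M) = expectation (\<lambda>\<omega>. indicator B (fst (X i \<omega>, X i \<omega>)) * f \<omega>)" for f :: "'a \<Rightarrow> real"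
      unfolding set_lebesgue_integral_def A by (intro Bochner_Integration.integral_cong) (auto simp: indicator_def)
    ultimately show "(\<integral>\<omega>\<in>A. of_bool (X i \<omega> < X j \<omega>) \<partial>M) = (\<integral>\<omega>\<in>A. survival (X j) (X i \<omega>) \<partial>M)" by simp
  next
    show "integrable M (\<lambda>\<omega>. of_bool (X i \<omega> < X j \<omega>) :: real)"
      by (intro integrable_const_bound[where B = 1]) auto
    show "integrable M (\<lambda>\<omega>. survival (X j) (X i \<omega>))"
      by (intro integrable_const_bound[where B = 1]) (auto simp: survival_bounds)
    show "(\<lambda>\<omega>. survival (X j) (X i \<omega>)) \<in> borel_measurable ?F"
      by (intro measurable_compose[OF XF] survival_measurable) auto
  qed
qed

text \<open>Given \<open>X\<^sub>i\<close>, the events \<open>X\<^sub>i < X\<^sub>j\<close> and \<open>X\<^sub>i < X\<^sub>k\<close> are independent. In the proof each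
  survival function is replaced by the event it is the conditional probability of, one
  after the other.\<close>

lemma expectation_cond_prob_product:
  assumes ind: "indep_vars (\<lambda>_. borel) X I" and I: "i \<in> I" "j \<in> I" "k \<in> I" and ne: "distinct [i, j, k]"
  shows "expectation (\<lambda>\<omega>. cond_prob_given M (\<lambda>\<omega>. X j \<omega> > X i \<omega>) (X i) \<omega> * cond_prob_given M (\<lambda>\<omega>. X k \<omega> > X i \<omega>) (X i) \<omega>)
       = \<P>(\<omega> in M. X i \<omega> < X j \<omega> \<and> X i \<omega> < X k \<omega>)"
proof -
  have [measurable]: "random_variable borel (X i)" "random_variable borel (X j)" "random_variable borel (X k)"
    using ind I by (auto simp: indep_vars_def)
  have "expectation (\<lambda>\<omega>. cond_prob_given M (\<lambda>\<omega>. X j \<omega> > X i \<omega>) (X i) \<omega> * cond_prob_given M (\<lambda>\<omega>. X k \<omega> > X i \<omega>) (X i) \<omega>)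
      = expectation (\<lambda>\<omega>. survival (X j) (X i \<omega>) * survival (X k) (X i \<omega>))"
  proof (rule integral_cong_AE)
    show "AE \<omega> in M. cond_prob_given M (\<lambda>\<omega>. X j \<omega> > X i \<omega>) (X i) \<omega> * cond_prob_given M (\<lambda>\<omega>. X k \<omega> > X i \<omega>) (X i) \<omega> =
        survival (X j) (X i \<omega>) * survival (X k) (X i \<omega>)"
      using cond_prob_given_eq_survival[OF ind I(1,2)] cond_prob_given_eq_survival[OF ind I(1,3)] ne by auto
  qed (simp_all add: cond_prob_given_def)
  also have "\<dots> = expectation (\<lambda>\<omega>. survival (X j) (fst (X i \<omega>, X i \<omega>)) * of_bool (X i \<omega> < X k \<omega>))"
    using ne by (subst expectation_order_indep[OF ind I(1,3,1), where B = 1]) (auto simp: survival_bounds)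
  also have "\<dots> = expectation (\<lambda>\<omega>. of_bool (fst (X i \<omega>, X k \<omega>) < snd (X i \<omega>, X k \<omega>)) * survival (X j) (X i \<omega>))"
    by (simp add: mult.commute)
  also have "\<dots> = expectation (\<lambda>\<omega>. of_bool (fst (X i \<omega>, X k \<omega>) < snd (X i \<omega>, X k \<omega>)) * of_bool (X i \<omega> < X j \<omega>))"
    using ne by (subst expectation_order_indep[OF ind I(1,2,3), where B = 1]) auto
  also have "\<dots> = expectation (indicator {\<omega>\<in>space M. X i \<omega> < X j \<omega> \<and> X i \<omega> < X k \<omega>})"
    by (intro Bochner_Integration.integral_cong) auto
  finally show ?thesis by simp
qed

text \<open>Whatever value \<open>X\<^sub>i\<close> takes, the independent \<open>X\<^sub>j\<close> hits it with probability at most \<open>c\<close>. This is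
  used with \<open>c = 0\<close> for the absolutely continuous observations and with \<open>c = 1/n\<close> for the bootstrap
  draws.\<close>

lemma prob_tie_le:
  assumes ind: "indep_vars (\<lambda>_. borel) X I" and I: "i \<in> I" "j \<in> I" and ne: "i \<noteq> j"
    and atom: "\<And>x. \<P>(\<omega> in M. X j \<omega> = x) \<le> c"
  shows "\<P>(\<omega> in M. X i \<omega> = (X j \<omega> :: real)) \<le> c"
proof -
  have [measurable]: "random_variable borel (X i)" "random_variable borel (X j)"
    using ind I by (auto simp: indep_vars_def)
  have iv: "indep_var (borel \<Otimes>\<^sub>M borel) (\<lambda>\<omega>. (X i \<omega>, X i \<omega>)) (borel \<Otimes>\<^sub>M borel) (\<lambda>\<omega>. (X j \<omega>, X j \<omega>))"
    using ne by (intro indep_var_pairs[OF ind]) (use I in auto)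
  define f where "f z = (of_bool (fst (fst z) = fst (snd z)) :: real)" for z :: "(real \<times> real) \<times> (real \<times> real)"
  have f: "f \<in> borel_measurable ((borel \<Otimes>\<^sub>M borel) \<Otimes>\<^sub>M (borel \<Otimes>\<^sub>M borel))"
    unfolding f_def by measurable
  have atom': "expectation (\<lambda>\<omega>. of_bool (x = X j \<omega>)) \<le> c" for x
  proof -
    have "expectation (\<lambda>\<omega>. of_bool (x = X j \<omega>) :: real) = expectation (indicator {\<omega>\<in>space M. X j \<omega> = x})"
      by (intro Bochner_Integration.integral_cong) auto
    thus ?thesis using atom[of x] by simp
  qed
  have "\<P>(\<omega> in M. X i \<omega> = X j \<omega>) = expectation (indicator {\<omega>\<in>space M. X i \<omega> = X j \<omega>})" by simp
  also have "\<dots> = expectation (\<lambda>\<omega>. f ((X i \<omega>, X i \<omega>), (X j \<omega>, X j \<omega>)))"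
    unfolding f_def by (intro Bochner_Integration.integral_cong) auto
  also have "\<dots> = expectation (\<lambda>\<omega>. expectation (\<lambda>\<omega>'. f ((X i \<omega>, X i \<omega>), (X j \<omega>', X j \<omega>'))))"
    by (rule expectation_indep_var_Fubini[OF iv f, where B = 1]) (simp add: f_def)
  also have "\<dots> \<le> expectation (\<lambda>\<omega>. c)"
  proof (rule integral_mono_AE')
    show "AE \<omega> in M. 0 \<le> c" using order_trans[OF measure_nonneg atom] by simp
  qed (use atom' in \<open>auto simp: f_def\<close>)
  finally show ?thesis by (simp add: prob_space)
qed

lemma prob_atom_absolutely_continuous:
  assumes [measurable]: "random_variable borel Y" and ac: "absolutely_continuous lborel (distr M borel Y)"
  shows "\<P>(\<omega> in M. Y \<omega> = (x :: real)) = 0"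
proof -
  have "{x} \<in> null_sets lborel" by (rule countable_imp_null_set_lborel) simp
  hence "{x} \<in> null_sets (distr M borel Y)"
    using ac unfolding absolutely_continuous_def by blast
  hence "emeasure M (Y -` {x} \<inter> space M) = 0"
    by (simp add: null_sets_distr_iff null_setsD1)
  moreover have "{\<omega>\<in>space M. Y \<omega> = x} = Y -` {x} \<inter> space M" by auto
  ultimately show ?thesis by (simp add: measure_def)
qed

end

section \<open>The bootstrap as resampling of indices\<close>

text \<open>Drawing indices instead of values moves the observed sample out of the probability space:
  conditional variances become finite sums over a fixed index space, hence measurable functions of the
  sample.\<close>

definition resampling_pmf :: "nat \<Rightarrow> (nat \<Rightarrow> nat) pmf" where
  "resampling_pmf n = Pi_pmf {1..n} 0 (\<lambda>_. pmf_of_set {1..n})"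

lemma set_resampling_pmf: "n > 0 \<Longrightarrow> set_pmf (resampling_pmf n) = PiE_dflt {1..n} 0 (\<lambda>_. {1..n})"
  unfolding resampling_pmf_def by (subst set_Pi_pmf) (simp_all add: comp_def set_pmf_of_set)

text \<open>The update \<open>x(0 := 0)\<close> matches the default values: the index draw is 0 outside \<open>{1..n}\<close>, where the
  bootstrap sample has the value 0.\<close>

lemma bootstrap_pmf_eq_map_resampling:
  assumes "n > 0"
  shows "bootstrap_pmf n x = map_pmf (\<lambda>g. x(0 := 0) \<circ> g) (resampling_pmf n)"
proof -
  have "empirical_pmf n x = map_pmf (x(0 := 0)) (pmf_of_set {1..n})"
    unfolding empirical_pmf_def using assms by (intro map_pmf_cong refl) (auto simp: set_pmf_of_set)
  thus ?thesis
    unfolding bootstrap_pmf_def resampling_pmf_def by (simp add: Pi_pmf_map)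
qed

lemma bootstrap_var_eq_resampling_variance:
  assumes "n > 0" and local: "\<And>y z. (\<And>i. i \<in> {1..n} \<Longrightarrow> y i = z i) \<Longrightarrow> T y = T z"
  shows "bootstrap_var n x T = measure_pmf.variance (resampling_pmf n) (\<lambda>g. T (\<lambda>i. x (g i)))"
proof -
  have eq: "T (x(0 := 0) \<circ> g) = T (\<lambda>i. x (g i))" if "g \<in> set_pmf (resampling_pmf n)" for g
    using that set_resampling_pmf[OF assms(1)] by (intro local) (auto simp: PiE_dflt_def)
  have int: "(\<integral>g. F (T (x(0 := 0) \<circ> g)) \<partial>resampling_pmf n) = (\<integral>g. F (T (\<lambda>i. x (g i))) \<partial>resampling_pmf n)" for F :: "real \<Rightarrow> real"
    by (intro integral_cong_AE) (auto simp: AE_measure_pmf_iff eq)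
  show ?thesis
    unfolding bootstrap_var_def bootstrap_pmf_eq_map_resampling[OF assms(1)] integral_map_pmf
    using int[of "\<lambda>t. t"] int by simp
qed

text \<open>Only finitely many index draws have positive probability.\<close>

lemma resampling_expectation_measurable:
  assumes "n > 0" and "\<And>g. g \<in> PiE_dflt {1..n} 0 (\<lambda>_. {1..n}) \<Longrightarrow> (\<lambda>\<omega>. F g \<omega>) \<in> borel_measurable N"
  shows "(\<lambda>\<omega>. measure_pmf.expectation (resampling_pmf n) (\<lambda>g. F g \<omega> :: real)) \<in> borel_measurable N"
proof -
  let ?A = "PiE_dflt {1..n} 0 (\<lambda>_. {1..n})"
  have "finite ?A" by (intro finite_PiE_dflt) auto
  hence "(\<lambda>\<omega>. measure_pmf.expectation (resampling_pmf n) (\<lambda>g. F g \<omega>)) = (\<lambda>\<omega>. \<Sum>g\<in>?A. F g \<omega> * pmf (resampling_pmf n) g)"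
    using set_resampling_pmf[OF assms(1)] by (intro ext integral_measure_pmf_real) auto
  thus ?thesis using assms(2) by (auto intro!: borel_measurable_sum borel_measurable_times)
qed

lemma inversions_measurable:
  assumes "\<And>i. i \<in> {1..n} \<Longrightarrow> (\<lambda>\<omega>. Z i \<omega>) \<in> borel_measurable N"
  shows "(\<lambda>\<omega>. inversions n (\<lambda>i. Z i \<omega>)) \<in> borel_measurable N"
  unfolding inversions_def
proof (intro borel_measurable_sum borel_measurable_times)
  fix i j assume "i \<in> {1..n}" "j \<in> {1..n}"
  note [measurable] = assms[OF this(1)] assms[OF this(2)]
  show "(\<lambda>\<omega>. of_bool (Z i \<omega> < Z j \<omega>)) \<in> borel_measurable N" by measurable
qed auto

lemma inversions_cong: "(\<And>i. i \<in> {1..n} \<Longrightarrow> y i = z i) \<Longrightarrow> inversions n y = inversions n z"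
  unfolding inversions_def by (intro sum.cong refl) simp

lemma bootstrap_var_inversions_measurable:
  assumes "\<And>i. i \<in> {1..n} \<Longrightarrow> X i \<in> borel_measurable N"
  shows "(\<lambda>\<omega>. bootstrap_var n (\<lambda>i. X i \<omega>) (inversions n)) \<in> borel_measurable N"
proof (cases "n = 0")
  case True
  (* The uniform distribution on the empty set is unspecified, but no draw is made from it. *)
  thus ?thesis by (simp add: bootstrap_var_def bootstrap_pmf_def)
next
  case False
  hence n: "n > 0" by simp
  have m: "(\<lambda>\<omega>. inversions n (\<lambda>i. X (g i) \<omega>)) \<in> borel_measurable N" if "g \<in> PiE_dflt {1..n} 0 (\<lambda>_. {1..n})" for g
    using that by (intro inversions_measurable assms) (auto simp: PiE_dflt_def)
  have "(\<lambda>\<omega>. bootstrap_var n (\<lambda>i. X i \<omega>) (inversions n)) = (\<lambda>\<omega>. measure_pmf.variance (resampling_pmf n) (\<lambda>g. inversions n (\<lambda>i. X (g i) \<omega>)))"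
    by (intro ext bootstrap_var_eq_resampling_variance n inversions_cong)
  also have "\<dots> \<in> borel_measurable N"
    by (intro resampling_expectation_measurable n borel_measurable_power borel_measurable_diff m)
  finally show ?thesis .
qed

lemma resampling_prob_transpose:
  assumes "i \<in> {1..n}" "j \<in> {1..n}"
  shows "measure_pmf.prob (resampling_pmf n) {g. P (g \<circ> Transposition.transpose i j)} = measure_pmf.prob (resampling_pmf n) {g. P g}"
proof -
  have "resampling_pmf n = map_pmf (\<lambda>g. g \<circ> Transposition.transpose i j) (resampling_pmf n)"
    unfolding resampling_pmf_def
  proof (rule Pi_pmf_bij_betw)
    show "bij_betw (Transposition.transpose i j) {1..n} {1..n}"
      using assms by (auto simp: bij_betw_def transpose_image_eq intro: inj_on_inverseI[where g = "Transposition.transpose i j"])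
    show "Transposition.transpose i j x \<notin> {1..n}" if "x \<notin> {1..n}" for x
      using assms that by (auto simp: Transposition.transpose_def)
  qed simp
  hence "measure_pmf.prob (resampling_pmf n) {g. P g} = measure_pmf.prob (map_pmf (\<lambda>g. g \<circ> Transposition.transpose i j) (resampling_pmf n)) {g. P g}"
    by (rule arg_cong)
  thus ?thesis by (simp add: vimage_def)
qed

text \<open>The draws are i.i.d., so the swap conditions hold without error; distinctness of the observations makes
  every value an atom of mass at most \<open>1/n\<close>.\<close>

lemma resampling_nearly_exchangeable:
  fixes x :: "nat \<Rightarrow> real"
  assumes n: "n > 0" and inj: "inj_on x {1..n}"
  shows "nearly_exchangeable (measure_pmf (resampling_pmf n)) n (\<lambda>i g. x (g i)) (1 / real n)"
proof -
  have ind: "prob_space.indep_vars (measure_pmf (resampling_pmf n)) (\<lambda>_. borel) (\<lambda>i g. x (g i)) {1..n}"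
    unfolding resampling_pmf_def
    by (rule prob_space.indep_vars_compose2[OF measure_pmf.prob_space_axioms indep_vars_Pi_pmf]) auto
  show ?thesis
  proof
    show "prob_space.indep_vars (measure_pmf (resampling_pmf n)) (\<lambda>_. borel) (\<lambda>i g. x (g i)) {1..n}" by (rule ind)
  next
    fix i j assume ij: "i \<in> {1..n}" "j \<in> {1..n}" "i \<noteq> j"
    show "\<bar>\<P>(g in resampling_pmf n. x (g i) < x (g j)) - \<P>(g in resampling_pmf n. x (g j) < x (g i))\<bar> \<le> 1 / real n"
      using resampling_prob_transpose[OF ij(1,2), of "\<lambda>g. x (g i) < x (g j)"] by simp
  next
    fix i j k assume ijk: "i \<in> {1..n}" "j \<in> {1..n}" "k \<in> {1..n}" "distinct [i, j, k]"
    show "\<bar>\<P>(g in resampling_pmf n. x (g i) < x (g j) \<and> x (g i) < x (g k)) -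
           \<P>(g in resampling_pmf n. x (g j) < x (g i) \<and> x (g j) < x (g k))\<bar> \<le> 1 / real n"
      using resampling_prob_transpose[OF ijk(1,2), of "\<lambda>g. x (g i) < x (g j) \<and> x (g i) < x (g k)"] ijk by simp
  next
    fix i j assume ij: "i \<in> {1..n}" "j \<in> {1..n}" "i \<noteq> j"
    have atom: "\<P>(g in resampling_pmf n. x (g j) = y) \<le> 1 / real n" for y
    proof -
      have "{m\<in>{1..n}. x m = y} \<subseteq> {the_inv_into {1..n} x y}"
        using the_inv_into_f_f[OF inj] by auto
      hence "card {m\<in>{1..n}. x m = y} \<le> 1"
        using card_mono[of "{the_inv_into {1..n} x y}"] by fastforce
      hence "measure_pmf.prob (pmf_of_set {1..n}) {m. x m = y} \<le> 1 / real n"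
        using n by (subst measure_pmf_of_set) (auto simp: Int_def divide_right_mono)
      moreover have "map_pmf (\<lambda>g. g j) (resampling_pmf n) = pmf_of_set {1..n}"
        unfolding resampling_pmf_def using ij by (simp add: Pi_pmf_component)
      ultimately have "measure_pmf.prob (map_pmf (\<lambda>g. g j) (resampling_pmf n)) {m. x m = y} \<le> 1 / real n"
        by simp
      thus ?thesis by (simp add: vimage_def)
    qed
    show "\<P>(g in resampling_pmf n. x (g i) = x (g j)) \<le> 1 / real n"
      by (rule measure_pmf.prob_tie_le[OF ind ij atom])
  qed auto
qed

section \<open>Comparing the two variances\<close>

lemma integral_variance_scale:
  fixes f :: "'a \<Rightarrow> real"
  shows "(\<integral>\<omega>. (c * f \<omega> - (\<integral>\<omega>. c * f \<omega> \<partial>M))\<^sup>2 \<partial>M) = c\<^sup>2 * (\<integral>\<omega>. (f \<omega> - (\<integral>\<omega>. f \<omega> \<partial>M))\<^sup>2 \<partial>M)"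
proof -
  have "(\<integral>\<omega>. (c * f \<omega> - (\<integral>\<omega>. c * f \<omega> \<partial>M))\<^sup>2 \<partial>M) = (\<integral>\<omega>. c\<^sup>2 * (f \<omega> - (\<integral>\<omega>. f \<omega> \<partial>M))\<^sup>2 \<partial>M)"
    by (simp add: power_mult_distrib flip: right_diff_distrib)
  thus ?thesis by simp
qed

lemma (in nearly_exchangeable) variance_inversions_cubic:
  assumes "n > 0"
  shows "\<bar>variance (\<lambda>\<omega>. inversions n (\<lambda>i. X i \<omega>)) - real n ^ 3 / 36\<bar> \<le> (32 * e + 2 / real n) * real n ^ 3"
proof -
  have "real n ^ 3 / 36 = real n * ((real n)\<^sup>2 - 1) / 36 + real n / 36"
    by (simp add: field_simps power2_eq_square power3_eq_cube)
  moreover have "(32 * e + 2 / real n) * real n ^ 3 = 32 * e * real n ^ 3 + 2 * (real n)\<^sup>2"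
    using assms by (simp add: field_simps power2_eq_square power3_eq_cube)
  moreover have "real n \<le> (real n)\<^sup>2"
    using assms by (simp add: power2_eq_square)
  ultimately show ?thesis
    using variance_inversions_approx unfolding abs_le_iff by linarith
qed

text \<open>Here \<open>V\<close> is the variance of the inversion count of the sample, \<open>W\<close> its bootstrap counterpart,
  \<open>c\<close> the normalisation of the statistic and \<open>N = n\<^sup>3\<close>. The factor \<open>(c/s)\<^sup>2\<close> is \<open>1/V\<close>, and
  \<open>r < 1/72\<close> keeps \<open>V\<close> above half of its limiting value \<open>N/36\<close>.\<close>

lemma variance_difference_bound:
  fixes V W N s c r :: real
  assumes V: "\<bar>V - N / 36\<bar> \<le> r * N" and W: "\<bar>W - N / 36\<bar> \<le> r * N" and N: "N > 0" and r: "r < 1 / 72"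
    and s: "s = sqrt (c\<^sup>2 * V)" and c: "c \<noteq> 0"
  shows "\<bar>(inverse s * c)\<^sup>2 * W - (inverse s * c)\<^sup>2 * V\<bar> \<le> 144 * r"
proof -
  have "r * N < 1/72 * N" using r N by (intro mult_strict_right_mono)
  hence Vlow: "V \<ge> N / 72" using V by (simp add: abs_le_iff)
  hence V0: "V > 0" using N by simp
  have "s\<^sup>2 = c\<^sup>2 * V" using s V0 by simp
  hence "(inverse s * c)\<^sup>2 = 1 / V"
    using c V0 by (simp add: power_mult_distrib power_inverse field_simps)
  hence "(inverse s * c)\<^sup>2 * W - (inverse s * c)\<^sup>2 * V = (W - V) / V"
    by (simp add: diff_divide_distrib)
  hence "\<bar>(inverse s * c)\<^sup>2 * W - (inverse s * c)\<^sup>2 * V\<bar> = \<bar>W - V\<bar> / V"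
    using V0 by (simp add: abs_divide)
  also have "\<dots> \<le> (2 * r * N) / V"
    using V W V0 by (intro divide_right_mono) (auto simp: abs_le_iff)
  also have "\<dots> \<le> (2 * r * N) / (N / 72)"
    using N Vlow V0 order_trans[OF abs_ge_zero V] by (intro divide_left_mono) (auto simp: mult.commute[of r N])
  also have "\<dots> = 144 * r" using N by simp
  finally show ?thesis .
qed

theorem corollary3p2:
  fixes M :: "nat \<Rightarrow> 'a measure"
    and X :: "nat \<Rightarrow> nat \<Rightarrow> 'a \<Rightarrow> real"
    and \<delta> p \<sigma> :: "nat \<Rightarrow> real"
    and \<theta> \<eta> C1 C2 :: real
  assumes prob: "\<And>n. prob_space (M n)"
    and indep: "\<And>n. prob_space.indep_vars (M n) (\<lambda>_. borel) (X n) {1..n}"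
    and abs_cont: "\<And>n i. i \<in> {1..n} \<Longrightarrow> absolutely_continuous lborel (distr (M n) borel (X n i))"
    and delta: "\<And>n. \<delta> n \<in> {0<..<1}"
    and p: "\<And>n. p n \<in> {0<..<1}"
    and separation: "\<forall>\<^sub>F n in sequentially. \<forall>i\<in>{1..n}.
      \<P>(\<omega> in M n. \<forall>j\<in>{1..n} - {i}.
          cond_prob_given (M n) (\<lambda>\<omega>. X n j \<omega> > X n i \<omega>) (X n i) \<omega>
            - \<P>(\<omega> in M n. X n j \<omega> > X n i \<omega>) \<in> {\<delta> n..1}) \<ge> p n
      \<or> \<P>(\<omega> in M n. \<forall>j\<in>{1..n} - {i}.
          cond_prob_given (M n) (\<lambda>\<omega>. X n j \<omega> > X n i \<omega>) (X n i) \<omega>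
            - \<P>(\<omega> in M n. X n j \<omega> > X n i \<omega>) \<in> {-1..- \<delta> n}) \<ge> p n"
    and rate: "gnsim (\<lambda>n. \<delta> n ^ 3 * p n) (\<lambda>n. real n powr (-1/3))"
    and theta_pos: "\<theta> > 0" and C1_pos: "C1 > 0"
    and theta: "\<And>n i j. i \<in> {1..n} \<Longrightarrow> j \<in> {1..n} \<Longrightarrow> i \<noteq> j \<Longrightarrow>
      \<bar>\<P>(\<omega> in M n. X n i \<omega> > X n j \<omega>) - \<theta>\<bar> \<le> C1 * real n powr (-1/6)"
    and eta_pos: "\<eta>\<^sup>2 > 0" and C2_pos: "C2 > 0"
    and eta: "\<And>n i j k. i \<in> {1..n} \<Longrightarrow> j \<in> {1..n} \<Longrightarrow> k \<in> {1..n} \<Longrightarrow> j \<noteq> i \<Longrightarrow> k \<noteq> i \<Longrightarrow>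
      \<bar>prob_space.expectation (M n) (\<lambda>\<omega>.
           cond_prob_given (M n) (\<lambda>\<omega>. X n j \<omega> > X n i \<omega>) (X n i) \<omega>
         * cond_prob_given (M n) (\<lambda>\<omega>. X n k \<omega> > X n i \<omega>) (X n i) \<omega>) - \<eta>\<^sup>2\<bar>
        \<le> C2 * real n powr (-1/3)"
    and eta_theta: "\<eta>\<^sup>2 \<noteq> \<theta>\<^sup>2"
    and sigma: "\<And>n. \<sigma> n = sqrt (prob_space.variance (M n) (\<lambda>\<omega>. U_Ken n (\<lambda>i. X n i \<omega>)))"
  shows "tendsto_zero_in_prob M (\<lambda>n \<omega>.
    \<bar>bootstrap_var n (\<lambda>i. X n i \<omega>) (\<lambda>x. inverse (\<sigma> n) * U_Ken n x)
      - prob_space.variance (M n) (\<lambda>\<omega>. inverse (\<sigma> n) * U_Ken n (\<lambda>i. X n i \<omega>))\<bar>)"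
proof -
  (* The swap conditions compare two probabilities, each of which is close to the same constant:
     hence the factor 2. The summand 1 makes room for the tie probability 1/n of the bootstrap. *)
  define K where "K = 2 * C1 + 2 * C2 + 1"
  define e where "e n = K * real n powr (-1/6)" for n
  define r where "r n = 32 * e n + 2 / real n" for n
  define c where "c n = 1 / (real n * (real n - 1))" for n
  define V where "V n = prob_space.variance (M n) (\<lambda>\<omega>. inversions n (\<lambda>i. X n i \<omega>))" for n
  define W where "W n \<omega> = bootstrap_var n (\<lambda>i. X n i \<omega>) (inversions n)" for n \<omega>
  define Y where "Y n \<omega> = \<bar>(inverse (\<sigma> n) * c n)\<^sup>2 * W n \<omega> - (inverse (\<sigma> n) * c n)\<^sup>2 * V n\<bar>" for n \<omega>
  have rv: "X n i \<in> borel_measurable (M n)" if "i \<in> {1..n}" for n i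
    using indep[of n] that by (auto simp: prob_space.indep_vars_def[OF prob])
  have U: "U_Ken n x = c n * inversions n x" for n x
    unfolding c_def by (simp add: U_Ken_eq_inversions)
  have sigma': "\<sigma> n = sqrt ((c n)\<^sup>2 * V n)" for n
    unfolding sigma U V_def integral_variance_scale ..
  have Y: "\<bar>bootstrap_var n (\<lambda>i. X n i \<omega>) (\<lambda>x. inverse (\<sigma> n) * U_Ken n x)
      - prob_space.variance (M n) (\<lambda>\<omega>. inverse (\<sigma> n) * U_Ken n (\<lambda>i. X n i \<omega>))\<bar> = Y n \<omega>" for n \<omega>
    unfolding U mult.assoc[symmetric] bootstrap_var_def integral_variance_scale Y_def V_def W_def ..
  have Y_meas: "Y n \<in> borel_measurable (M n)" for n
  proof -
    have "W n \<in> borel_measurable (M n)"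
      unfolding W_def by (intro bootstrap_var_inversions_measurable rv)
    thus ?thesis unfolding Y_def by measurable
  qed
  have e_bounds: "2 * (C1 * real n powr (-1/6)) \<le> e n" "2 * (C2 * real n powr (-1/3)) \<le> e n" "1 / real n \<le> e n" "0 \<le> e n"
    if "n > 0" for n
  proof -
    have a: "real n powr (-1/3) \<le> real n powr (-1/6)" "real n powr (-1) \<le> real n powr (-1/6)"
      by (rule powr_mono; use that in simp)+
    have "C2 * real n powr (-1/3) \<le> C2 * real n powr (-1/6)"
      using a C2_pos by simp
    moreover have "0 \<le> C1 * real n powr (-1/6)" "0 \<le> C2 * real n powr (-1/6)" "0 \<le> real n powr (-1/6)"
      using C1_pos C2_pos by auto
    moreover have "1 / real n = real n powr (-1)"
      using that by (simp add: powr_minus_divide)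
    moreover have "e n = 2 * (C1 * real n powr (-1/6)) + 2 * (C2 * real n powr (-1/6)) + real n powr (-1/6)"
      unfolding e_def K_def by (simp add: algebra_simps)
    ultimately show "2 * (C1 * real n powr (-1/6)) \<le> e n" "2 * (C2 * real n powr (-1/3)) \<le> e n" "1 / real n \<le> e n" "0 \<le> e n"
      using a by linarith+
  qed
  have tie0: "\<P>(\<omega> in M n. X n i \<omega> = X n j \<omega>) = 0" if "i \<in> {1..n}" "j \<in> {1..n}" "i \<noteq> j" for n i j
  proof -
    interpret prob_space "M n" by (rule prob)
    have "\<P>(\<omega> in M n. X n j \<omega> = x) \<le> 0" for x
      using prob_atom_absolutely_continuous[OF rv abs_cont] that by simp
    hence "\<P>(\<omega> in M n. X n i \<omega> = X n j \<omega>) \<le> 0"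
      by (rule prob_tie_le[OF indep that])
    thus ?thesis using measure_nonneg[of "M n"] order_antisym by blast
  qed
  have V_approx: "\<bar>V n - real n ^ 3 / 36\<bar> \<le> r n * real n ^ 3" if n: "n > 0" for n
  proof -
    interpret prob_space "M n" by (rule prob)
    interpret nearly_exchangeable "M n" n "X n" "e n"
    proof
      show "indep_vars (\<lambda>_. borel) (X n) {1..n}" by (rule indep)
    next
      fix i j assume ij: "i \<in> {1..n}" "j \<in> {1..n}" "i \<noteq> j"
      show "\<bar>\<P>(\<omega> in M n. X n i \<omega> < X n j \<omega>) - \<P>(\<omega> in M n. X n j \<omega> < X n i \<omega>)\<bar> \<le> e n"
        using theta[OF ij] theta[OF ij(2,1)] ij(3) e_bounds[OF n] by (simp add: abs_le_iff)
      show "\<P>(\<omega> in M n. X n i \<omega> = X n j \<omega>) \<le> e n"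
        using tie0[OF ij] e_bounds[OF n] by simp
    next
      fix i j k assume ijk: "i \<in> {1..n}" "j \<in> {1..n}" "k \<in> {1..n}" "distinct [i, j, k]"
      have *: "\<bar>\<P>(\<omega> in M n. X n a \<omega> < X n b \<omega> \<and> X n a \<omega> < X n k \<omega>) - \<eta>\<^sup>2\<bar> \<le> C2 * real n powr (-1/3)"
        if "a \<in> {1..n}" "b \<in> {1..n}" "distinct [a, b, k]" for a b
        using eta[of a n b k] that ijk(3) expectation_cond_prob_product[OF indep that(1,2) ijk(3) that(3)] by auto
      show "\<bar>\<P>(\<omega> in M n. X n i \<omega> < X n j \<omega> \<and> X n i \<omega> < X n k \<omega>) - \<P>(\<omega> in M n. X n j \<omega> < X n i \<omega> \<and> X n j \<omega> < X n k \<omega>)\<bar> \<le> e n"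
        using *[of i j] *[of j i] ijk e_bounds[OF n] by (simp add: abs_le_iff)
    qed (use e_bounds[OF n] in auto)
    show ?thesis
      unfolding V_def r_def by (rule variance_inversions_cubic[OF n])
  qed
  have W_approx: "AE \<omega> in M n. \<bar>W n \<omega> - real n ^ 3 / 36\<bar> \<le> r n * real n ^ 3" if n: "n > 0" for n
  proof -
    interpret prob_space "M n" by (rule prob)
    have "AE \<omega> in M n. X n i \<omega> \<noteq> X n j \<omega>" if "i \<in> {1..n}" "j \<in> {1..n} - {i}" for i j
    proof -
      have [measurable]: "X n i \<in> borel_measurable (M n)" "X n j \<in> borel_measurable (M n)"
        using that by (auto intro: rv)
      have "{\<omega>\<in>space (M n). X n i \<omega> = X n j \<omega>} \<in> events" by measurable
      from prob_Collect_eq_0[OF this] show ?thesis using tie0[of i n j] that by auto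
    qed
    hence "AE \<omega> in M n. \<forall>i\<in>{1..n}. \<forall>j\<in>{1..n} - {i}. X n i \<omega> \<noteq> X n j \<omega>"
      by (intro AE_finite_allI) auto
    thus ?thesis
    proof (rule AE_mp, intro AE_I2 impI)
      fix \<omega> assume "\<forall>i\<in>{1..n}. \<forall>j\<in>{1..n} - {i}. X n i \<omega> \<noteq> X n j \<omega>"
      hence inj: "inj_on (\<lambda>i. X n i \<omega>) {1..n}" by (auto simp: inj_on_def)
      have "W n \<omega> = measure_pmf.variance (resampling_pmf n) (\<lambda>g. inversions n (\<lambda>i. X n (g i) \<omega>))"
        unfolding W_def by (intro bootstrap_var_eq_resampling_variance n inversions_cong)
      hence "\<bar>W n \<omega> - real n ^ 3 / 36\<bar> \<le> (32 * (1 / real n) + 2 / real n) * real n ^ 3"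
        using nearly_exchangeable.variance_inversions_cubic[OF resampling_nearly_exchangeable[OF n inj] n] by simp
      also have "\<dots> \<le> r n * real n ^ 3"
        unfolding r_def using e_bounds(3)[OF n] by (intro mult_right_mono) auto
      finally show "\<bar>W n \<omega> - real n ^ 3 / 36\<bar> \<le> r n * real n ^ 3" .
    qed
  qed
  have r_lim: "r \<longlonglongrightarrow> 0"
  proof -
    have "(\<lambda>n. real n powr (-1/6)) \<longlonglongrightarrow> 0"
      by (rule tendsto_neg_powr[OF _ filterlim_real_sequentially]) simp
    hence "(\<lambda>n. 32 * (K * real n powr (-1/6)) + 2 / real n) \<longlonglongrightarrow> 32 * (K * 0) + 0"
      by (intro tendsto_intros lim_const_over_n)
    thus ?thesis unfolding r_def[abs_def] e_def by simp
  qed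
  have "(\<lambda>n. \<P>(\<omega> in M n. \<bar>Y n \<omega>\<bar> > \<epsilon>)) \<longlonglongrightarrow> 0" if eps: "\<epsilon> > 0" for \<epsilon>
  proof (rule tendsto_eventually)
    have "\<forall>\<^sub>F n in sequentially. r n < min (1/72) (\<epsilon> / 144)"
      using eps by (intro order_tendstoD[OF r_lim]) auto
    moreover have "\<forall>\<^sub>F n in sequentially. n \<ge> 2" by (rule eventually_ge_at_top)
    ultimately show "\<forall>\<^sub>F n in sequentially. \<P>(\<omega> in M n. \<bar>Y n \<omega>\<bar> > \<epsilon>) = 0"
    proof eventually_elim
      case (elim n)
      interpret prob_space "M n" by (rule prob)
      have n: "n > 0" and c: "c n \<noteq> 0" using elim by (auto simp: c_def)
      have "AE \<omega> in M n. \<not> \<bar>Y n \<omega>\<bar> > \<epsilon>"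
        using W_approx[OF n]
      proof (rule AE_mp, intro AE_I2 impI)
        fix \<omega> assume "\<bar>W n \<omega> - real n ^ 3 / 36\<bar> \<le> r n * real n ^ 3"
        hence "Y n \<omega> \<le> 144 * r n"
          unfolding Y_def using elim n c
          by (intro variance_difference_bound[OF V_approx[OF n] _ _ _ sigma']) auto
        thus "\<not> \<bar>Y n \<omega>\<bar> > \<epsilon>" using elim by (simp add: Y_def)
      qed
      moreover have "{\<omega>\<in>space (M n). \<bar>Y n \<omega>\<bar> > \<epsilon>} \<in> events"
        using Y_meas[of n] by measurable
      ultimately show ?case by (subst prob_Collect_eq_0)
    qed
  qed
  thus ?thesis
    unfolding tendsto_zero_in_prob_def Y using Y_meas by blast
qed

end
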